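(* Let $h$ be a positive integer and let $(A_1,\ldots,A_h)$ be a multiplicative complement of order $h$. Let $\tau_1,\ldots,\tau_h\in(0,1)$ be such that $\sum_{i=1}^h\tau_i=1$ and $$\limsup_{x\to\infty}A_i(x)\frac{(\log x)^{1-\tau_i}}{x}<\infty$$ for all $1\le i\le h$. Then $$\prod_{i=1}^h\frac1{\Gamma(\tau_i)}\ \le\ \prod_{i=1}^h\limsup_{x\to\infty}A_i(x)\frac{(\log x)^{1-\tau_i}}{x}.$$
   Context: $\mathbb{Z}^+$ denotes the set of positive integers, $\log$ the natural logarithm, and $\Gamma$ the Euler gamma function. For $A\subseteq\mathbb{Z}^+$, the counting function is $A(x)=|\{a\in A:a\le x\}|$. An $h$-tuple $(A_1,\ldots,A_h)$ of subsets of $\mathbb{Z}^+$ is a multiplicative complement of order $h$ if every positive integer can be written in the form $a_1\cdots a_h$ with $a_i\in A_i$ for all $1\le i\le h$. *)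

theory Defs
  imports "HOL-Analysis.Analysis"
begin

definition counting :: "nat set \<Rightarrow> real \<Rightarrow> nat" where
  "counting A x = card {a \<in> A. real a \<le> x}"

definition mult_complement :: "nat \<Rightarrow> (nat \<Rightarrow> nat set) \<Rightarrow> bool" where
  "mult_complement h A \<longleftrightarrow>
     (\<forall>i\<in>{1..h}. A i \<subseteq> {0<..}) \<and>
     (\<forall>n>0. \<exists>a. (\<forall>i\<in>{1..h}. a i \<in> A i) \<and> n = (\<Prod>i=1..h. a i))"

text \<open>The limit superior is taken in the extended reals, so that it exists unconditionally
  and its finiteness is a genuine hypothesis.\<close>

definition limsup_density :: "nat set \<Rightarrow> real \<Rightarrow> ereal" where
  "limsup_density A \<tau> =
     Limsup at_top (\<lambda>x::real. ereal (real (counting A x) * (ln x powr (1 - \<tau>) / x)))"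

end

theory Submission
  imports Defs
begin

text \<open>With \<open>B\<^sub>i(s) = \<Sum>a\<in>A i. a powr -s\<close>, the covering property gives
  \<open>1 / (s - 1) \<le> \<zeta>(s) \<le> \<Prod>i. B\<^sub>i(s)\<close> for \<open>s > 1\<close>. If \<open>A i\<close> has counting function at most
  \<open>C\<^sub>i x (ln x) powr (\<tau> i - 1)\<close> for large \<open>x\<close>, then partial summation and the Gamma integral give
  \<open>B\<^sub>i(s) \<le> K\<^sub>i + s C\<^sub>i \<Gamma>(\<tau> i) (s - 1) powr -\<tau> i\<close>. Multiplying by
  \<open>s - 1 = \<Prod>i. (s - 1) powr \<tau> i\<close> and letting \<open>s\<close> tend to 1 yields \<open>1 \<le> \<Prod>i. C\<^sub>i \<Gamma>(\<tau> i)\<close>.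
  Infinite sums are avoided by truncating all of them at the same \<open>N\<close>.\<close>

lemma has_integral_Ioi_iff_Ici:
  fixes f :: "real \<Rightarrow> 'a :: banach" and a :: real
  shows "(f has_integral y) {a<..} \<longleftrightarrow> (f has_integral y) {a..}"
  by (rule has_integral_spike_set_eq; rule negligible_subset[OF negligible_sing[of a]]) auto

text \<open>Substitute \<open>u * t\<close> for \<open>t\<close> in Euler's integral. This is done
  on the open half-line, which scaling maps onto itself; the endpoint is a null set. Absolute
  integrability, needed for the change of variables, comes from nonnegativity.\<close>

lemma Gamma_integral_real_scaled:
  fixes u x :: real
  assumes "x > 0" "u > 0"
  shows "((\<lambda>t. exp (- u * t) * t powr (x - 1)) has_integral Gamma x * u powr (- x)) {0..}"
proof -
  define f where "f = (\<lambda>t::real. t powr (x - 1) / exp t)"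
  have f_int: "(f has_integral Gamma x) {0<..}"
    using Gamma_integral_real[OF assms(1)] by (simp add: f_def has_integral_Ioi_iff_Ici)
  hence "f absolutely_integrable_on {0<..}"
    by (intro nonnegative_absolutely_integrable_1) (auto simp: f_def integrable_on_def)
  moreover have img: "(\<lambda>t. u * t) ` {0<..} = {0<..}"
    using assms(2) by (auto simp: image_iff intro!: bexI[of _ "_ / u"])
  moreover have "inj_on (\<lambda>t. u * t) {0<..}"
    using assms(2) by (auto simp: inj_on_def)
  moreover have "((\<lambda>t. u * t) has_field_derivative u) (at t within {0<..})" for t
    by (auto intro!: derivative_eq_intros)
  ultimately have "(\<lambda>t. \<bar>u\<bar> * f (u * t)) absolutely_integrable_on {0<..} \<and>
      integral {0<..} (\<lambda>t. \<bar>u\<bar> * f (u * t)) = Gamma x"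
    using has_absolute_integral_change_of_variables_1'[of "{0<..}" "\<lambda>t. u * t" "\<lambda>_. u" f "Gamma x"]
      integral_unique[OF f_int] by simp
  hence "((\<lambda>t. \<bar>u\<bar> * f (u * t)) has_integral Gamma x) {0<..}"
    using set_lebesgue_integral_eq_integral(1) has_integral_integral by metis
  \<comment> \<open>The Jacobian \<open>u\<close> and the factor \<open>u powr (x - 1)\<close>
    inside \<open>f (u * t)\<close> combine to \<open>u powr x\<close>, which this multiplier
    cancels.\<close>
  hence "((\<lambda>t. u powr (- x) * (\<bar>u\<bar> * f (u * t))) has_integral u powr (- x) * Gamma x) {0<..}"
    by (rule has_integral_mult_right)
  also have "?this \<longleftrightarrow> ((\<lambda>t. exp (- u * t) * t powr (x - 1)) has_integral u powr (- x) * Gamma x) {0<..}"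
  proof (rule has_integral_cong)
    fix t :: real assume t: "t \<in> {0<..}"
    have "u powr (- x) * (\<bar>u\<bar> * f (u * t)) =
        (u powr (- x) * u powr 1 * u powr (x - 1)) * (exp (- u * t) * t powr (x - 1))"
      using t assms(2) by (simp add: f_def powr_mult exp_minus divide_inverse)
    also have "u powr (- x) * u powr 1 * u powr (x - 1) = 1"
      using assms(2) by (simp only: powr_add[symmetric]) simp
    finally show "u powr (- x) * (\<bar>u\<bar> * f (u * t)) = exp (- u * t) * t powr (x - 1)"
      by simp
  qed
  finally show ?thesis
    by (simp add: has_integral_Ioi_iff_Ici mult.commute)
qed

text \<open>Comparison with the integral of \<open>z powr - (1 + u)\<close>, which is decreasing: by
  the mean value theorem each term dominates the increment of \<open>- (z powr - u) / u\<close> up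
  to the next integer, and the increments telescope. The left side tends to \<open>1 / u\<close>,
  the pole of zeta.\<close>

lemma sum_powr_lower_bound:
  fixes u :: real
  assumes "u > 0"
  shows "(1 - real (Suc N) powr (- u)) / u \<le> (\<Sum>n=1..N. real n powr - (1 + u))"
proof (induction N)
  case (Suc N)
  let ?a = "real (Suc N)" and ?b = "real (Suc (Suc N))"
  have "\<exists>z. ?a < z \<and> z < ?b \<and> - (?b powr (- u)) - - (?a powr (- u)) = (?b - ?a) * (u * z powr (- u - 1))"
    by (rule MVT2) (auto intro!: derivative_eq_intros)
  then obtain z where z: "?a < z" "?a powr (- u) - ?b powr (- u) = u * z powr (- u - 1)"
    by auto
  have "z powr (- u - 1) \<le> ?a powr (- u - 1)"
    using z(1) assms by (intro powr_mono2') auto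
  hence "?a powr (- u) - ?b powr (- u) \<le> u * ?a powr - (1 + u)"
    using z(2) assms by simp (simp add: minus_diff_commute)
  hence "(?a powr (- u) - ?b powr (- u)) / u \<le> ?a powr - (1 + u)"
    using assms by (simp add: field_simps)
  thus ?case
    using Suc.IH by (simp add: diff_divide_distrib)
qed simp

text \<open>Partial summation in the variable \<open>t = ln x\<close>: each term is the integral of
  \<open>E\<close> over \<open>{ln a..}\<close>, so the sum is the integral of a truncated counting
  function against \<open>E\<close>. A pointwise majorant then suffices. The resulting bound is
  independent of \<open>N\<close>.\<close>

lemma sum_powr_le_if_counting_le:
  fixes C T u \<tau> :: real
  assumes "A \<subseteq> {0<..}" "T \<ge> 0" "C \<ge> 0" "u > 0" "\<tau> > 0"
    and le: "\<And>t. t > T \<Longrightarrow> real (counting A (exp t)) \<le> C * (exp t * t powr (\<tau> - 1))"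
  shows "(\<Sum>a\<in>{a\<in>A. a \<le> N}. real a powr - (1 + u))
           \<le> real (counting A (exp T)) + (1 + u) * C * Gamma \<tau> * u powr (- \<tau>)"
proof (rule has_integral_le)
  define B where "B = {a\<in>A. a \<le> N}"
  define E where "E = (\<lambda>t. (1 + u) * exp (- (1 + u) * t))"
  have finB: "finite B" by (simp add: B_def)
  have E_int: "(E has_integral exp (- (1 + u) * c)) {c..}" for c
    using has_integral_mult_right[OF has_integral_exp_minus_to_infinity[of "1 + u" c], of "1 + u"] assms(4)
    by (simp add: E_def)
  have E_nonneg: "E t \<ge> 0" for t
    using assms(4) by (simp add: E_def)
  show "((\<lambda>t. \<Sum>a\<in>B. if t \<in> {ln a..} then E t else 0) has_integral
      (\<Sum>a\<in>{a\<in>A. a \<le> N}. real a powr - (1 + u))) {0..}"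
    unfolding B_def[symmetric]
  proof (rule has_integral_sum[OF finB])
    fix a assume "a \<in> B"
    hence a: "a > 0" using assms(1) by (auto simp: B_def)
    hence "{ln (real a)..} \<subseteq> {0..}" by simp
    moreover have "exp (- (1 + u) * ln (real a)) = real a powr - (1 + u)"
      using a by (simp add: powr_def)
    ultimately show "((\<lambda>t. if t \<in> {ln a..} then E t else 0) has_integral real a powr - (1 + u)) {0..}"
      using E_int[of "ln a"] has_integral_restrict by metis
  qed
  \<comment> \<open>\<open>E\<close> has total mass 1 on \<open>{0..}\<close>, so the first summand
    contributes just the constant.\<close>
  show "((\<lambda>t. real (counting A (exp T)) * E t + (1 + u) * C * (exp (- u * t) * t powr (\<tau> - 1)))
      has_integral real (counting A (exp T)) + (1 + u) * C * Gamma \<tau> * u powr (- \<tau>)) {0..}"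
    using has_integral_add[OF has_integral_mult_right[OF E_int[of 0], of "real (counting A (exp T))"]
        has_integral_mult_right[OF Gamma_integral_real_scaled[OF assms(5,4)], of "(1 + u) * C"]]
    by (simp add: mult.assoc)
  have fin: "finite {a \<in> A. real a \<le> x}" for x
    by (rule finite_subset[of _ "{..nat \<lfloor>x\<rfloor>}"]) (auto simp: le_nat_floor)
  fix t :: real assume t: "t \<in> {0..}"
  have "(\<Sum>a\<in>B. if t \<in> {ln a..} then E t else 0) = real (card {a\<in>B. ln a \<le> t}) * E t"
    using finB by (simp add: sum.If_cases Int_def)
  also have "{a\<in>B. ln (real a) \<le> t} \<subseteq> {a\<in>A. real a \<le> exp t}"
  proof safe
    fix a assume "a \<in> B" "ln (real a) \<le> t"
    moreover from this have "real a > 0" using assms(1) by (auto simp: B_def)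
    ultimately show "real a \<le> exp t" by (metis exp_le_cancel_iff exp_ln)
  qed (simp add: B_def)
  hence "real (card {a\<in>B. ln a \<le> t}) * E t \<le> real (counting A (exp t)) * E t"
    unfolding counting_def using fin E_nonneg
    by (intro mult_right_mono of_nat_mono card_mono) auto
  also have "\<dots> \<le> real (counting A (exp T)) * E t + (1 + u) * C * (exp (- u * t) * t powr (\<tau> - 1))"
  \<comment> \<open>Up to \<open>T\<close> the first summand of the majorant suffices by
    monotonicity of the count, beyond \<open>T\<close> the second by \<open>le\<close>. Both are
    nonnegative, so their sum works everywhere.\<close>
  proof (cases "t \<le> T")
    case True
    hence "counting A (exp t) \<le> counting A (exp T)"
      unfolding counting_def using fin by (intro card_mono) (auto intro: order_trans)
    hence "real (counting A (exp t)) * E t \<le> real (counting A (exp T)) * E t"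
      using E_nonneg by (intro mult_right_mono) auto
    moreover have "0 \<le> (1 + u) * C * (exp (- u * t) * t powr (\<tau> - 1))"
      using assms by simp
    ultimately show ?thesis by linarith
  next
    case False
    hence "real (counting A (exp t)) * E t \<le> C * (exp t * t powr (\<tau> - 1)) * E t"
      using E_nonneg by (intro mult_right_mono le) auto
    also have "\<dots> = (1 + u) * C * (exp t * exp (- (1 + u) * t) * t powr (\<tau> - 1))"
      by (simp add: E_def)
    also have "exp t * exp (- (1 + u) * t) = exp (- u * t)"
      by (simp add: exp_add[symmetric] algebra_simps)
    finally show ?thesis
      using mult_nonneg_nonneg[OF of_nat_0_le_iff[of "counting A (exp T)"] E_nonneg[of t]] by linarith
  qed
  finally show "(\<Sum>a\<in>B. if t \<in> {ln a..} then E t else 0) \<le>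
      real (counting A (exp T)) * E t + (1 + u) * C * (exp (- u * t) * t powr (\<tau> - 1))" .
qed

text \<open>Choose one factorisation for each \<open>n\<close> up to \<open>N\<close>. Expanding the
  right side gives nonnegative terms indexed by all tuples, and the chosen tuples alone already
  produce the left side.\<close>

lemma mult_complement_sum_powr_le:
  fixes s :: real
  assumes "mult_complement h A"
  shows "(\<Sum>n=1..N. real n powr s) \<le> (\<Prod>i=1..h. \<Sum>a\<in>{a\<in>A i. a \<le> N}. real a powr s)"
proof -
  define B where "B = (\<lambda>i. {a\<in>A i. a \<le> N})"
  have "\<forall>n\<in>{1..N}. \<exists>p\<in>PiE {1..h} B. (\<Prod>i=1..h. p i) = n"
  proof
    fix n assume n: "n \<in> {1..N}"
    hence "n > 0" by simp
    then obtain a where a: "\<forall>i\<in>{1..h}. a i \<in> A i" "n = (\<Prod>i=1..h. a i)"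
      using assms unfolding mult_complement_def by blast
    \<comment> \<open>Truncating every factor at the same \<open>N\<close> loses nothing, since a
      factor of \<open>n\<close> divides \<open>n\<close>.\<close>
    have "a i \<le> N" if "i \<in> {1..h}" for i
    proof -
      have "a i dvd n" unfolding a(2) using that by (intro dvd_prodI) auto
      hence "a i \<le> n" using n by (intro dvd_imp_le) auto
      thus ?thesis using n by simp
    qed
    hence "restrict a {1..h} \<in> PiE {1..h} B"
      using a(1) by (auto simp: B_def)
    moreover have "(\<Prod>i=1..h. restrict a {1..h} i) = n"
      using a(2) by simp
    ultimately show "\<exists>p\<in>PiE {1..h} B. (\<Prod>i=1..h. p i) = n" by blast
  qed
  then obtain p where p: "\<And>n. n \<in> {1..N} \<Longrightarrow> p n \<in> PiE {1..h} B"
      "\<And>n. n \<in> {1..N} \<Longrightarrow> (\<Prod>i=1..h. p n i) = n"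
    by metis
  \<comment> \<open>The product of the tuple \<open>p n\<close> recovers \<open>n\<close>.\<close>
  have "inj_on p {1..N}"
    by (rule inj_onI) (metis p(2))
  have "(\<Sum>n=1..N. real n powr s) = (\<Sum>n=1..N. \<Prod>i=1..h. real (p n i) powr s)"
  proof (rule sum.cong)
    fix n assume "n \<in> {1..N}"
    hence "real n = (\<Prod>i=1..h. real (p n i))"
      using p(2) by (metis of_nat_prod)
    thus "real n powr s = (\<Prod>i=1..h. real (p n i) powr s)"
      by (simp add: prod_powr_distrib)
  qed simp
  also have "\<dots> = (\<Sum>q\<in>p ` {1..N}. \<Prod>i=1..h. real (q i) powr s)"
    by (simp only: sum.reindex[OF \<open>inj_on p {1..N}\<close>] comp_def)
  also have "\<dots> \<le> (\<Sum>q\<in>PiE {1..h} B. \<Prod>i=1..h. real (q i) powr s)"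
  proof (rule sum_mono2)
    show "finite (PiE {1..h} B)" by (intro finite_PiE) (auto simp: B_def)
    show "p ` {1..N} \<subseteq> PiE {1..h} B" using p(1) by blast
  qed (simp add: prod_nonneg)
  also have "\<dots> = (\<Prod>i=1..h. \<Sum>a\<in>B i. real a powr s)"
    by (rule prod_sum_PiE[symmetric]) (auto simp: B_def)
  finally show ?thesis by (simp add: B_def)
qed

text \<open>Excludes -\<infinity>, so that a limsup below \<infinity> is a real number, and makes
  any real bound above it nonnegative.\<close>

lemma limsup_density_nonneg: "limsup_density A \<tau> \<ge> 0"
  unfolding limsup_density_def
proof (rule le_Limsup)
  show "\<forall>\<^sub>F x in at_top. 0 \<le> ereal (real (counting A x) * (ln x powr (1 - \<tau>) / x))"
    using eventually_ge_at_top[of 0] by eventually_elim simp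
qed simp

lemma counting_le_if_limsup_density_less:
  assumes "limsup_density A \<tau> < ereal C"
  obtains T where "T \<ge> 0"
    "\<And>t. t > T \<Longrightarrow> real (counting A (exp t)) \<le> C * (exp t * t powr (\<tau> - 1))"
proof -
  have "eventually (\<lambda>x. ereal (real (counting A x) * (ln x powr (1 - \<tau>) / x)) < ereal C) at_top"
    using assms unfolding limsup_density_def by (rule Limsup_lessD)
  then obtain X where X: "\<And>x. x \<ge> X \<Longrightarrow> real (counting A x) * (ln x powr (1 - \<tau>) / x) < C"
    by (auto simp: eventually_at_top_linorder)
  show thesis
  proof (rule that)
    \<comment> \<open>Beyond \<open>X\<close>, \<open>exp t\<close> exceeds \<open>X\<close> as
      well; the 0 ensures \<open>t > 0\<close>, so that the two powers of \<open>t\<close>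
      cancel.\<close>
    fix t assume t: "t > max 0 X"
    hence "exp t \<ge> X" using exp_ge_add_one_self[of t] by linarith
    from X[OF this] have "real (counting A (exp t)) * (t powr (1 - \<tau>) / exp t) \<le> C" by simp
    hence "real (counting A (exp t)) * (t powr (1 - \<tau>) / exp t) * (exp t * t powr (\<tau> - 1))
        \<le> C * (exp t * t powr (\<tau> - 1))"
      by (rule mult_right_mono) simp
    moreover have "t powr (1 - \<tau>) * t powr (\<tau> - 1) = 1"
      using t by (simp add: powr_add[symmetric])
    ultimately show "real (counting A (exp t)) \<le> C * (exp t * t powr (\<tau> - 1))"
      by (simp add: mult_ac)
  qed simp
qed

lemma one_le_prod_Gamma:
  fixes C \<tau> :: "nat \<Rightarrow> real"
  assumes compl: "mult_complement h A"
    and \<tau>: "\<And>i. i \<in> {1..h} \<Longrightarrow> \<tau> i > 0" "(\<Sum>i=1..h. \<tau> i) = 1"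
    and C: "\<And>i. i \<in> {1..h} \<Longrightarrow> limsup_density (A i) (\<tau> i) < ereal (C i)"
  shows "1 \<le> (\<Prod>i=1..h. C i * Gamma (\<tau> i))"
proof -
  have "\<exists>T\<ge>0. \<forall>t>T. real (counting (A i) (exp t)) \<le> C i * (exp t * t powr (\<tau> i - 1))"
    if "i \<in> {1..h}" for i
    using counting_le_if_limsup_density_less[OF C[OF that]] by metis
  then obtain T where T: "\<And>i. i \<in> {1..h} \<Longrightarrow> T i \<ge> 0"
    "\<And>i t. i \<in> {1..h} \<Longrightarrow> t > T i \<Longrightarrow>
      real (counting (A i) (exp t)) \<le> C i * (exp t * t powr (\<tau> i - 1))"
    by metis
  define K where "K = (\<lambda>i. real (counting (A i) (exp (T i))))"
  have C_nonneg: "C i \<ge> 0" if "i \<in> {1..h}" for i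
    using le_less_trans[OF limsup_density_nonneg C[OF that]] by simp
  have A_pos: "A i \<subseteq> {0<..}" if "i \<in> {1..h}" for i
    using compl that by (auto simp: mult_complement_def)
  have bound: "1 \<le> (\<Prod>i=1..h. K i * u powr \<tau> i + (1 + u) * C i * Gamma (\<tau> i))" if u: "u > 0" for u
  proof -
    define P where "P = (\<Prod>i=1..h. K i + (1 + u) * C i * Gamma (\<tau> i) * u powr (- \<tau> i))"
    have "(1 - real (Suc N) powr (- u)) / u \<le> P" for N
    proof -
      have "(1 - real (Suc N) powr (- u)) / u \<le> (\<Sum>n=1..N. real n powr - (1 + u))"
        by (rule sum_powr_lower_bound[OF u])
      also have "\<dots> \<le> (\<Prod>i=1..h. \<Sum>a\<in>{a\<in>A i. a \<le> N}. real a powr - (1 + u))"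
        by (rule mult_complement_sum_powr_le[OF compl])
      also have "\<dots> \<le> P"
        unfolding P_def K_def
        by (intro prod_mono conjI sum_nonneg sum_powr_le_if_counting_le A_pos T C_nonneg u \<tau>(1)) auto
      finally show ?thesis .
    qed
    \<comment> \<open>\<open>P\<close> does not depend on \<open>N\<close>, so the limit in
      \<open>N\<close> may be taken with \<open>u\<close> fixed.\<close>
    moreover have "(\<lambda>N. (1 - real (Suc N) powr (- u)) / u) \<longlonglongrightarrow> (1 - 0) / u"
      using u by (intro tendsto_intros tendsto_neg_powr
          filterlim_compose[OF filterlim_real_sequentially filterlim_Suc]) auto
    ultimately have "1 / u \<le> P"
      by (intro LIMSEQ_le_const2[where X = "\<lambda>N. (1 - real (Suc N) powr (- u)) / u"]) auto
    hence "1 \<le> u * P" using u by (simp add: field_simps)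
    \<comment> \<open>As the \<tau>s sum to 1, \<open>u\<close> splits into one power for each
      factor of \<open>P\<close>: it cancels \<open>u powr (- \<tau> i)\<close> and moves a positive
      power of \<open>u\<close> onto \<open>K i\<close>.\<close>
    moreover have "u = (\<Prod>i=1..h. u powr \<tau> i)"
      using u \<tau>(2) powr_sum[of u \<tau> "{1..h}"] by simp
    moreover have "(\<Prod>i=1..h. u powr \<tau> i) * P
        = (\<Prod>i=1..h. K i * u powr \<tau> i + (1 + u) * C i * Gamma (\<tau> i))"
      unfolding P_def prod.distrib[symmetric]
      using u by (intro prod.cong refl) (simp add: powr_minus field_simps)
    ultimately show ?thesis by simp
  qed
  have "((\<lambda>u. \<Prod>i=1..h. K i * u powr \<tau> i + (1 + u) * C i * Gamma (\<tau> i))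
      \<longlongrightarrow> (\<Prod>i=1..h. K i * 0 + (1 + 0) * C i * Gamma (\<tau> i))) (at_right 0)"
  \<comment> \<open>Positivity of \<open>\<tau> i\<close> makes the contribution of
    \<open>K i\<close>, which depends on where the counting estimate starts, vanish in the
    limit.\<close>
  proof (intro tendsto_intros)
    fix i assume "i \<in> {1..h}"
    thus "((\<lambda>u::real. u powr \<tau> i) \<longlongrightarrow> 0) (at_right 0)"
      using \<tau>(1) by (auto intro!: tendsto_eq_intros eventually_mono[OF eventually_at_right_less])
  qed
  moreover have "eventually (\<lambda>u. 1 \<le> (\<Prod>i=1..h. K i * u powr \<tau> i + (1 + u) * C i * Gamma (\<tau> i)))
      (at_right 0)"
    by (rule eventually_mono[OF eventually_at_right_less bound])
  ultimately have "1 \<le> (\<Prod>i=1..h. K i * 0 + (1 + 0) * C i * Gamma (\<tau> i))"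
    by (rule tendsto_lowerbound) simp
  thus ?thesis by simp
qed

theorem corollary6:
  fixes h :: nat and A :: "nat \<Rightarrow> nat set" and \<tau> :: "nat \<Rightarrow> real"
  assumes "h > 0"
    and "mult_complement h A"
    and "\<And>i. i \<in> {1..h} \<Longrightarrow> \<tau> i \<in> {0<..<1}"
    and "(\<Sum>i=1..h. \<tau> i) = 1"
    and "\<And>i. i \<in> {1..h} \<Longrightarrow> limsup_density (A i) (\<tau> i) < \<infinity>"
  shows "ereal (\<Prod>i=1..h. 1 / Gamma (\<tau> i)) \<le> (\<Prod>i=1..h. limsup_density (A i) (\<tau> i))"
proof -
  define l where "l = (\<lambda>i. real_of_ereal (limsup_density (A i) (\<tau> i)))"
  have l: "limsup_density (A i) (\<tau> i) = ereal (l i)" if "i \<in> {1..h}" for i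
    using assms(5)[OF that] limsup_density_nonneg[of "A i" "\<tau> i"]
    by (cases "limsup_density (A i) (\<tau> i)") (auto simp: l_def)
  \<comment> \<open>The slack \<open>e\<close> supplies the strict inequality; it is removed
    afterwards by letting \<open>e\<close> tend to 0 from the right.\<close>
  have lower: "1 \<le> (\<Prod>i=1..h. (l i + e) * Gamma (\<tau> i))" if "e > 0" for e
    using that assms(3) by (intro one_le_prod_Gamma[OF assms(2) _ assms(4)]) (auto simp: l)
  have "((\<lambda>e. \<Prod>i=1..h. (l i + e) * Gamma (\<tau> i)) \<longlongrightarrow> (\<Prod>i=1..h. (l i + 0) * Gamma (\<tau> i)))
      (at_right 0)"
    by (intro tendsto_intros)
  moreover have "\<forall>\<^sub>F e in at_right 0. 1 \<le> (\<Prod>i=1..h. (l i + e) * Gamma (\<tau> i))"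
    by (rule eventually_mono[OF eventually_at_right_less lower])
  ultimately have "1 \<le> (\<Prod>i=1..h. (l i + 0) * Gamma (\<tau> i))"
    by (rule tendsto_lowerbound) simp
  moreover have "(\<Prod>i=1..h. Gamma (\<tau> i)) > 0"
    using assms(3) by (intro prod_pos) auto
  ultimately have "(\<Prod>i=1..h. 1 / Gamma (\<tau> i)) \<le> (\<Prod>i=1..h. l i)"
    by (simp add: prod.distrib prod_dividef field_simps)
  also have "ereal (\<Prod>i=1..h. l i) = (\<Prod>i=1..h. limsup_density (A i) (\<tau> i))"
    by (simp add: l flip: prod_ereal)
  finally show ?thesis by simp
qed

end
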